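(* For any two one-counter nets, the weak simulation approximants converge at level $\omega^2$, i.e. $\sqsubseteq_{\omega^2}$ equals the weak simulation preorder $\sqsubseteq$; and this does not hold earlier in general: for every ordinal $\alpha<\omega^2$ there exist one-counter nets for which $\sqsubseteq_\alpha\ne\;\sqsubseteq$.
   Context: OCN $(Q,\mathrm{Act},\delta)$ with $\delta\subseteq Q\times\mathrm{Act}\times\{-1,0,1\}\times Q$ induces the LTS on $Q\times\mathbb N$ with $pm\xrightarrow{a}qn$ iff $(p,a,d,q)\in\delta$, $n=m+d\ge0$; relations between two nets are on the disjoint union of their LTSs. With silent action $\tau\in\mathrm{Act}$, weak steps are $\overset{\tau}{\Longrightarrow}=(\xrightarrow{\tau})^*$ and $\overset{a}{\Longrightarrow}=(\xrightarrow{\tau})^*\xrightarrow{a}(\xrightarrow{\tau})^*$ for $a\ne\tau$. Weak simulation preorder $\sqsubseteq$: largest $R$ such that $(c,c')\in R$, $c\xrightarrow{a}d$ imply some $c'\overset{a}{\Longrightarrow}d'$ with $(d,d')\in R$. Weak simulation approximants for ordinals: $\sqsubseteq_0$ is the full relation; $s\sqsubseteq_{\alpha+1}s'$ iff for all $s\xrightarrow{a}t$ there is $s'\overset{a}{\Longrightarrow}t'$ with $t\sqsubseteq_\alpha t'$; for limit $\lambda$, $\sqsubseteq_\lambda=\bigcap_{\alpha<\lambda}\sqsubseteq_\alpha$. *)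

theory Defs
  imports Complex_Main
begin

record ('q, 'a) ocn =
  ctrl :: "'q set"
  acts :: "'a set"
  rules :: "('q \<times> 'a \<times> int \<times> 'q) set"

text \<open>As usual for one-counter nets, control states and action labels are finite; the silent
  action is required to be one of the labels.\<close>

definition is_ocn :: "'a \<Rightarrow> ('q, 'a) ocn \<Rightarrow> bool" where
  "is_ocn \<tau> N \<longleftrightarrow> finite (ctrl N) \<and> finite (acts N) \<and> \<tau> \<in> acts N \<and>
     rules N \<subseteq> ctrl N \<times> acts N \<times> {-1, 0, 1} \<times> ctrl N"

record ('s, 'a) lts =
  states :: "'s set"
  transitions :: "('s \<times> 'a \<times> 's) set"

definition ocn_lts :: "('q, 'a) ocn \<Rightarrow> ('q \<times> nat, 'a) lts" where
  "ocn_lts N = \<lparr>states = ctrl N \<times> UNIV,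
     transitions = {((p, m), a, (q, n)) | p m a q n. \<exists>d. (p, a, d, q) \<in> rules N \<and> int n = int m + d}\<rparr>"

definition lts_disjoint_union :: "('s, 'a) lts \<Rightarrow> ('t, 'a) lts \<Rightarrow> ('s + 't, 'a) lts" where
  "lts_disjoint_union L L' = \<lparr>states = states L <+> states L',
     transitions = {(Inl s, a, Inl t) | s a t. (s, a, t) \<in> transitions L} \<union>
             {(Inr s, a, Inr t) | s a t. (s, a, t) \<in> transitions L'}\<rparr>"

definition strong_step :: "('s, 'a) lts \<Rightarrow> 'a \<Rightarrow> 's rel" where
  "strong_step L a = {(s, t). (s, a, t) \<in> transitions L}"

definition weak_step :: "'a \<Rightarrow> ('s, 'a) lts \<Rightarrow> 'a \<Rightarrow> 's rel" where
  "weak_step \<tau> L a =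
     (if a = \<tau> then (strong_step L \<tau>)\<^sup>*
      else (strong_step L \<tau>)\<^sup>* O strong_step L a O (strong_step L \<tau>)\<^sup>*)"

definition sim_step :: "'a \<Rightarrow> ('s, 'a) lts \<Rightarrow> 's rel \<Rightarrow> 's rel" where
  "sim_step \<tau> L R = {(s, s') \<in> states L \<times> states L.
     \<forall>a t. (s, t) \<in> strong_step L a \<longrightarrow> (\<exists>t'. (s', t') \<in> weak_step \<tau> L a \<and> (t, t') \<in> R)}"

definition is_weak_simulation :: "'a \<Rightarrow> ('s, 'a) lts \<Rightarrow> 's rel \<Rightarrow> bool" where
  "is_weak_simulation \<tau> L R \<longleftrightarrow> R \<subseteq> states L \<times> states L \<and>
     (\<forall>(c, c') \<in> R. \<forall>a d. (c, d) \<in> strong_step L a \<longrightarrow>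
        (\<exists>d'. (c', d') \<in> weak_step \<tau> L a \<and> (d, d') \<in> R))"

definition weak_sim :: "'a \<Rightarrow> ('s, 'a) lts \<Rightarrow> 's rel" where
  "weak_sim \<tau> L = \<Union>{R. is_weak_simulation \<tau> L R}"

lemma weak_sim_largest:
  "is_weak_simulation \<tau> L (weak_sim \<tau> L)"
  "is_weak_simulation \<tau> L R \<Longrightarrow> R \<subseteq> weak_sim \<tau> L"
proof -
  show "is_weak_simulation \<tau> L R \<Longrightarrow> R \<subseteq> weak_sim \<tau> L"
    by (auto simp: weak_sim_def)
  show "is_weak_simulation \<tau> L (weak_sim \<tau> L)"
    unfolding is_weak_simulation_def
  proof (intro conjI ballI)
    show "weak_sim \<tau> L \<subseteq> states L \<times> states L"
      unfolding weak_sim_def is_weak_simulation_def by blast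
  next
    fix x assume "x \<in> weak_sim \<tau> L"
    then obtain R where R: "is_weak_simulation \<tau> L R" "x \<in> R"
      by (auto simp: weak_sim_def)
    from R(1) have "R \<subseteq> weak_sim \<tau> L" by (auto simp: weak_sim_def)
    with R show "case x of (c, c') \<Rightarrow> \<forall>a d. (c, d) \<in> strong_step L a \<longrightarrow>
        (\<exists>d'. (c', d') \<in> weak_step \<tau> L a \<and> (d, d') \<in> weak_sim \<tau> L)"
      unfolding is_weak_simulation_def by fast
  qed
qed

text \<open>An ordinal is represented by an element of a well-order \<open>r\<close> (a relation on an arbitrary
  type): the element \<open>\<alpha>\<close> stands for the order type of the initial segment strictly below it.
  \<open>covers r \<beta> \<alpha>\<close> then says that \<open>\<alpha>\<close> is the successor of \<open>\<beta>\<close>.\<close>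

definition covers :: "'o rel \<Rightarrow> 'o \<Rightarrow> 'o \<Rightarrow> bool" where
  "covers r \<beta> \<alpha> \<longleftrightarrow> \<beta> \<in> underS r \<alpha> \<and> (\<forall>\<gamma> \<in> underS r \<alpha>. (\<gamma>, \<beta>) \<in> r)"

definition weak_sim_approx :: "'a \<Rightarrow> ('s, 'a) lts \<Rightarrow> 'o rel \<Rightarrow> 'o \<Rightarrow> 's rel" where
  "weak_sim_approx \<tau> L r = wo_rel.worec r (\<lambda>f \<alpha>.
     if underS r \<alpha> = {} then states L \<times> states L
     else if \<exists>\<beta>. covers r \<beta> \<alpha> then sim_step \<tau> L (f (THE \<beta>. covers r \<beta> \<alpha>))
     else (\<Inter>\<beta> \<in> underS r \<alpha>. f \<beta>))"

lemma covers_unique: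
  assumes "Well_order r" "covers r \<beta> \<alpha>" "covers r \<gamma> \<alpha>"
  shows "\<beta> = \<gamma>"
proof -
  have "(\<beta>, \<gamma>) \<in> r" "(\<gamma>, \<beta>) \<in> r" using assms(2,3) by (auto simp: covers_def)
  moreover have "antisym r"
    using assms(1) by (auto simp: order_on_defs)
  ultimately show ?thesis by (auto dest: antisymD)
qed

lemma weak_sim_approx_unfold:
  assumes "Well_order r"
  shows "weak_sim_approx \<tau> L r \<alpha> =
    (if underS r \<alpha> = {} then states L \<times> states L
     else if \<exists>\<beta>. covers r \<beta> \<alpha> then sim_step \<tau> L (weak_sim_approx \<tau> L r (THE \<beta>. covers r \<beta> \<alpha>))
     else (\<Inter>\<beta> \<in> underS r \<alpha>. weak_sim_approx \<tau> L r \<beta>))"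
proof -
  have wo: "wo_rel r" using assms by (simp add: wo_rel_def)
  have the: "(THE \<beta>. covers r \<beta> \<alpha>) \<in> underS r \<alpha>" if ex: "\<exists>\<beta>. covers r \<beta> \<alpha>" for \<alpha>
  proof -
    from ex obtain \<beta> where b: "covers r \<beta> \<alpha>" by blast
    then have "(THE \<beta>. covers r \<beta> \<alpha>) = \<beta>"
      using covers_unique[OF assms] by blast
    with b show ?thesis by (simp add: covers_def)
  qed
  define H where "H = (\<lambda>f \<alpha>.
     if underS r \<alpha> = {} then states L \<times> states L
     else if \<exists>\<beta>. covers r \<beta> \<alpha> then sim_step \<tau> L (f (THE \<beta>. covers r \<beta> \<alpha>))
     else (\<Inter>\<beta> \<in> underS r \<alpha>. f \<beta>))"
  have "wo_rel.adm_wo r H"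
    unfolding wo_rel.adm_wo_def[OF wo] H_def using the by auto
  from wo_rel.worec_fixpoint[OF wo this]
  have "weak_sim_approx \<tau> L r = H (weak_sim_approx \<tau> L r)"
    unfolding weak_sim_approx_def H_def .
  then have "weak_sim_approx \<tau> L r \<alpha> = H (weak_sim_approx \<tau> L r) \<alpha>" by metis
  then show ?thesis by (simp only: H_def)
qed

lemma weak_sim_approx_zero:
  "Well_order r \<Longrightarrow> underS r \<alpha> = {} \<Longrightarrow> weak_sim_approx \<tau> L r \<alpha> = states L \<times> states L"
  by (simp add: weak_sim_approx_unfold)

lemma weak_sim_approx_succ:
  assumes "Well_order r" "covers r \<beta> \<alpha>"
  shows "weak_sim_approx \<tau> L r \<alpha> = sim_step \<tau> L (weak_sim_approx \<tau> L r \<beta>)"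
proof -
  have "(THE \<beta>. covers r \<beta> \<alpha>) = \<beta>"
    using assms covers_unique[OF assms(1)] by blast
  moreover have "underS r \<alpha> \<noteq> {}" using assms(2) by (auto simp: covers_def)
  ultimately show ?thesis
    using assms(2) by (subst weak_sim_approx_unfold[OF assms(1)]) auto
qed

lemma weak_sim_approx_limit:
  "Well_order r \<Longrightarrow> underS r \<alpha> \<noteq> {} \<Longrightarrow> \<nexists>\<beta>. covers r \<beta> \<alpha> \<Longrightarrow>
     weak_sim_approx \<tau> L r \<alpha> = (\<Inter>\<beta> \<in> underS r \<alpha>. weak_sim_approx \<tau> L r \<beta>)"
  by (subst weak_sim_approx_unfold) auto

text \<open>The ordinal \<open>\<omega>\<^sup>2 = \<omega> \<cdot> \<omega>\<close>, with the pair \<open>(i, j)\<close> as \<open>\<omega> \<cdot> i + j\<close>.\<close>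

definition omega_squared :: "(nat \<times> nat) rel" where
  "omega_squared = (less_than <*lex*> less_than)\<^sup>="

definition represents_omega_squared :: "'o rel \<Rightarrow> 'o \<Rightarrow> bool" where
  "represents_omega_squared r \<alpha> \<longleftrightarrow>
     Well_order r \<and> \<alpha> \<in> Field r \<and> (Restr r (underS r \<alpha>), omega_squared) \<in> ordIso"

lemma represents_omega_squared_exists:
  "\<exists>(r :: (nat \<times> nat) option rel) \<alpha>. represents_omega_squared r \<alpha>"
proof -
  let ?l = "less_than <*lex*> less_than :: (nat \<times> nat) rel"
  define r where "r = map_prod Some Some ` omega_squared \<union> {(x, None) | x. True}"
  have F: "Field r = UNIV" by (auto simp: r_def Field_def)
  have FO: "Field omega_squared = UNIV" by (auto simp: omega_squared_def Field_def)
  have r_simps: "(Some x, Some y) \<in> r \<longleftrightarrow> (x, y) \<in> omega_squared" "(z, None) \<in> r"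
    "(None, Some y) \<notin> r" for x y z
    by (auto simp: r_def)
  have O: "Well_order omega_squared"
  proof -
    have "omega_squared - Id \<subseteq> ?l" by (auto simp: omega_squared_def)
    then have "wf (omega_squared - Id)" by (rule wf_subset[rotated]) auto
    then show ?thesis
      unfolding order_on_defs FO
      by (auto simp: omega_squared_def refl_on_def total_on_def antisym_def trans_def)
  qed
  have "wf (r - Id)"
  proof (rule wfUNIVI)
    fix P :: "(nat \<times> nat) option \<Rightarrow> bool" and x
    assume step: "\<forall>x. (\<forall>y. (y, x) \<in> r - Id \<longrightarrow> P y) \<longrightarrow> P x"
    have S: "P (Some y)" for y
    proof (induction y rule: wf_induct[OF wf_lex_prod[OF wf_less_than wf_less_than]])
      case (1 y)
      show ?case
      proof (rule step[rule_format])
        fix z assume z: "(z, Some y) \<in> r - Id"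
        then obtain z' where "z = Some z'" by (cases z) (auto simp: r_simps)
        with z have "(z', y) \<in> ?l" by (auto simp: r_simps omega_squared_def)
        with 1 \<open>z = Some z'\<close> show "P z" by blast
      qed
    qed
    show "P x"
    proof (cases x)
      case None
      show ?thesis
      proof (rule step[rule_format])
        fix z assume "(z, x) \<in> r - Id"
        with None have "z \<noteq> None" by auto
        then show "P z" using S by auto
      qed
    qed (use S in simp)
  qed
  moreover have "refl r" "trans r" "antisym r" "total r"
  proof -
    have O': "refl omega_squared" "trans omega_squared" "antisym omega_squared" "total omega_squared"
      using O unfolding order_on_defs FO by auto
    show "refl r"
    proof (rule refl_onI)
      fix x :: "(nat \<times> nat) option" show "(x, x) \<in> r"
        using O'(1) by (cases x) (auto simp: r_simps refl_on_def)
    qed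
    show "trans r"
    proof (rule transI)
      fix x y z assume "(x, y) \<in> r" "(y, z) \<in> r"
      then show "(x, z) \<in> r"
        using O'(2) by (cases x; cases y; cases z) (auto simp: r_simps dest: transD)
    qed
    show "antisym r"
    proof (rule antisymI)
      fix x y assume "(x, y) \<in> r" "(y, x) \<in> r"
      then show "x = y"
        using O'(3) by (cases x; cases y) (auto simp: r_simps dest: antisymD)
    qed
    show "total r"
      unfolding total_on_def
    proof (intro ballI impI)
      fix x y :: "(nat \<times> nat) option" assume "x \<noteq> y"
      then show "(x, y) \<in> r \<or> (y, x) \<in> r"
        using O'(4) by (cases x; cases y) (auto simp: r_simps total_on_def)
    qed
  qed
  ultimately have W: "Well_order r"
    unfolding order_on_defs F by auto
  have U: "underS r None = range Some"
    by (auto simp: underS_def r_simps)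
  let ?R = "Restr r (underS r None)"
  have WR: "Well_order ?R" by (rule Well_order_Restr[OF W])
  have FR: "Field ?R = range Some"
  proof
    show "Field ?R \<subseteq> range Some" unfolding U by (auto simp: Field_def)
    have "(Some x, Some x) \<in> ?R" for x
      unfolding U by (auto simp: r_simps omega_squared_def)
    then show "range Some \<subseteq> Field ?R" by (auto intro: FieldI1)
  qed
  have "iso omega_squared ?R Some"
    unfolding iso_iff3[OF O WR] FR FO
    by (auto simp: U r_simps bij_betw_def compat_def)
  then have "(omega_squared, ?R) \<in> ordIso" using O WR by (auto simp: ordIso_def)
  then have "represents_omega_squared r None"
    using W F by (auto simp: represents_omega_squared_def intro: ordIso_symmetric)
  then show ?thesis by blast
qed

end

theory Submission
  imports Defs "HOL-Library.Infinite_Set"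
begin

text \<open>Both the preorder and its approximants are monotone in the two counters. For controls \<open>c\<close>, \<open>d\<close>,
  consider the spoiler counters \<open>m\<close> such that no duplicator counter puts \<open>c m\<close> below \<open>d n\<close> at level
  \<open>\<omega> \<cdot> i\<close>. These sets are upward closed and grow with \<open>i\<close>, so there is an \<open>i\<close> where they all stop growing.
  Then \<open>\<sqsubseteq>\<close> at level \<open>\<omega> \<cdot> (i + 1)\<close> is a weak simulation: an attack has either
  finitely many relevant answers, one of which is good at cofinally many levels, or answers with
  unboundedly large counters, one of which is good because the sets did not grow.

  Conversely, against a spoiler that loops on a visible action, a duplicator whose counter decreases
  with each answer and can be reset \<open>k\<close> times survives \<open>\<omega> \<cdot> k\<close> levels, but not forever.\<close>

section \<open>Approximants below \<open>\<omega>\<^sup>2\<close>\<close>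

text \<open>The approximant at level \<omega> \<cdot> i, stated without a well-order; level \<omega>
  \<cdot> i + j is then its \<open>j\<close>-th iterate under \<open>sim_step\<close>.\<close>

primrec limit_approx :: "'a \<Rightarrow> ('s, 'a) lts \<Rightarrow> nat \<Rightarrow> 's rel" where
  "limit_approx \<tau> L 0 = states L \<times> states L"
| "limit_approx \<tau> L (Suc i) = (\<Inter>j. (sim_step \<tau> L ^^ j) (limit_approx \<tau> L i))"

section \<open>Monotonicity of the simulation step\<close>

lemma sim_step_mono: "R \<subseteq> R' \<Longrightarrow> sim_step \<tau> L R \<subseteq> sim_step \<tau> L R'"
  unfolding sim_step_def by blast

lemma sim_step_subset_states: "sim_step \<tau> L R \<subseteq> states L \<times> states L"
  unfolding sim_step_def by blast

text \<open>Makes the iterates above each limit level decreasing. In the successor case,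
  \<open>j = 0\<close> follows from the induction hypothesis and \<open>j > 0\<close> from
  monotonicity applied to iterate \<open>j - 1\<close>.\<close>

lemma sim_step_limit_approx_subset: "sim_step \<tau> L (limit_approx \<tau> L i) \<subseteq> limit_approx \<tau> L i"
proof (induction i)
  case 0
  show ?case by (simp add: sim_step_subset_states)
next
  case (Suc i)
  let ?R = "\<lambda>j. (sim_step \<tau> L ^^ j) (limit_approx \<tau> L i)"
  have "sim_step \<tau> L (\<Inter>j. ?R j) \<subseteq> ?R j" for j
  proof -
    have "sim_step \<tau> L (\<Inter>j. ?R j) \<subseteq> sim_step \<tau> L (?R k)" for k
      by (rule sim_step_mono) blast
    from this[of 0] this[of "j - 1"] Suc show ?thesis by (cases j) auto
  qed
  then show ?case by auto
qed

lemma iterate_sim_step_antimono: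
  assumes "sim_step \<tau> L R \<subseteq> R" "j \<le> k"
  shows "(sim_step \<tau> L ^^ k) R \<subseteq> (sim_step \<tau> L ^^ j) R"
proof -
  have "(sim_step \<tau> L ^^ Suc n) R \<subseteq> (sim_step \<tau> L ^^ n) R" for n
    by (induction n) (use assms(1) in \<open>auto dest: subsetD[OF sim_step_mono]\<close>)
  then show ?thesis by (rule lift_Suc_antimono_le) (rule assms(2))
qed

lemma limit_approx_Suc_subset:
  "limit_approx \<tau> L (Suc i) \<subseteq> (sim_step \<tau> L ^^ j) (limit_approx \<tau> L i)"
  by auto

lemma limit_approx_antimono: "i \<le> j \<Longrightarrow> limit_approx \<tau> L j \<subseteq> limit_approx \<tau> L i"
proof (rule lift_Suc_antimono_le)
  show "limit_approx \<tau> L (Suc n) \<subseteq> limit_approx \<tau> L n" for n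
    using limit_approx_Suc_subset[of \<tau> L n 0] by simp
qed

lemma limit_approx_subset_states: "limit_approx \<tau> L i \<subseteq> states L \<times> states L"
  using limit_approx_antimono[of 0 i \<tau> L] by simp

section \<open>The preorder below all approximants\<close>

lemma is_weak_simulation_iff_sim_step: "is_weak_simulation \<tau> L R \<longleftrightarrow> R \<subseteq> sim_step \<tau> L R"
  unfolding is_weak_simulation_def sim_step_def by blast

lemma weak_sim_subset_iterate:
  assumes "weak_sim \<tau> L \<subseteq> R"
  shows "weak_sim \<tau> L \<subseteq> (sim_step \<tau> L ^^ j) R"
proof (induction j)
  case (Suc j)
  have "weak_sim \<tau> L \<subseteq> sim_step \<tau> L (weak_sim \<tau> L)"
    using weak_sim_largest(1) is_weak_simulation_iff_sim_step by metis
  also have "\<dots> \<subseteq> sim_step \<tau> L ((sim_step \<tau> L ^^ j) R)"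
    by (rule sim_step_mono[OF Suc])
  finally show ?case by simp
qed (use assms in simp)

lemma weak_sim_subset_limit_approx: "weak_sim \<tau> L \<subseteq> limit_approx \<tau> L i"
proof (induction i)
  case 0
  show ?case using weak_sim_largest(1)[of \<tau> L] by (simp add: is_weak_simulation_def)
next
  case (Suc i)
  then show ?case using weak_sim_subset_iterate by (metis INT_greatest limit_approx.simps(2))
qed

section \<open>Agreement with the ordinal-indexed approximants\<close>

text \<open>Reads the order isomorphism as an enumeration, so that \<open>g (i, j)\<close> is the
  ordinal \<omega> \<cdot> i + j inside \<open>r\<close>.\<close>

lemma represents_omega_squared_enum:
  assumes "represents_omega_squared r \<Omega>"
  obtains g where "underS r \<Omega> = range g" "\<And>x y. (g x, g y) \<in> r \<longleftrightarrow> (x, y) \<in> omega_squared"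
proof -
  let ?R = "Restr r (underS r \<Omega>)"
  have W: "Well_order r" and "(omega_squared, ?R) \<in> ordIso"
    using assms by (auto simp: represents_omega_squared_def intro: ordIso_symmetric)
  then obtain g where O: "Well_order omega_squared" "Well_order ?R" and g: "iso omega_squared ?R g"
    by (auto simp: ordIso_def)
  have "Field omega_squared = UNIV" by (auto simp: omega_squared_def Field_def)
  moreover have F: "Field ?R = underS r \<Omega>"
    using W by (auto simp: Field_def underS_def order_on_defs refl_on_def)
  ultimately have b: "bij_betw g UNIV (underS r \<Omega>)"
    and iff: "\<And>x y. (x, y) \<in> omega_squared \<longleftrightarrow> (g x, g y) \<in> ?R"
    using g iso_iff2[of omega_squared ?R g] by auto
  show ?thesis
  proof
    show R: "underS r \<Omega> = range g" using b by (simp add: bij_betw_def)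
    show "(g x, g y) \<in> r \<longleftrightarrow> (x, y) \<in> omega_squared" for x y
      unfolding iff R by auto
  qed
qed

lemma limit_approx_subset_iterate:
  "k < i \<Longrightarrow> limit_approx \<tau> L i \<subseteq> (sim_step \<tau> L ^^ j) (limit_approx \<tau> L k)"
  using limit_approx_antimono[of "Suc k" i \<tau> L] limit_approx_Suc_subset[of \<tau> L k j]
  by (auto simp del: limit_approx.simps)

text \<open>The pairs \<open>(i, Suc j)\<close> are successors, while \<open>(Suc i, 0)\<close> and
  \<open>\<Omega>\<close> are limits, so the clauses of \<open>weak_sim_approx\<close> turn into
  those of \<open>limit_approx\<close> and finite iteration of \<open>sim_step\<close>.\<close>

lemma weak_sim_approx_omega_squared:
  assumes rep: "represents_omega_squared r \<Omega>"
    and R: "underS r \<Omega> = range g"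
    and g: "\<And>x y. (g x, g y) \<in> r \<longleftrightarrow> (x, y) \<in> omega_squared"
  shows "weak_sim_approx \<tau> L r (g (i, j)) = (sim_step \<tau> L ^^ j) (limit_approx \<tau> L i)"
    and "weak_sim_approx \<tau> L r \<Omega> = (\<Inter>i. limit_approx \<tau> L i)"
proof -
  have W: "Well_order r" using rep by (simp add: represents_omega_squared_def)
  then have tr: "trans r" and anti: "antisym r" by (auto simp: order_on_defs)
  have g_inj: "g x = g y \<longleftrightarrow> x = y" for x y
    using g[of x y] g[of y x] g[of x x] by (cases x; cases y) (auto simp: omega_squared_def)
  have U: "underS r (g x) = g ` {y. (y, x) \<in> less_than <*lex*> less_than}" for x
  proof -
    \<comment> \<open>Everything below \<open>g x\<close> lies strictly below
      \<open>\<Omega>\<close>, hence in the range of \<open>g\<close>; no other element of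
      \<open>r\<close> can intervene.\<close>
    have "(z, \<Omega>) \<in> r \<and> z \<noteq> \<Omega>" if "(z, g x) \<in> r" for z
    proof -
      have "g x \<in> underS r \<Omega>" using R by blast
      then have "(g x, \<Omega>) \<in> r" "g x \<noteq> \<Omega>" by (auto simp: underS_def)
      then show ?thesis using that tr anti by (metis antisymD transD)
    qed
    then have "underS r (g x) \<subseteq> range g" unfolding R[symmetric] by (auto simp: underS_def)
    then show ?thesis
      by (force simp: underS_def g g_inj omega_squared_def)
  qed
  have cov: "covers r (g (i, j)) (g (i, Suc j))" for i j
    unfolding covers_def U by (auto simp: g omega_squared_def)
  have nocov: "\<nexists>\<beta>. covers r \<beta> (g (Suc i, 0))" for i
  proof
    assume "\<exists>\<beta>. covers r \<beta> (g (Suc i, 0))"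
    then obtain k j where c: "covers r (g (k, j)) (g (Suc i, 0))" "k < Suc i"
      unfolding covers_def U by auto
    \<comment> \<open>A predecessor \<open>g (k, j)\<close> would have to bound
      \<open>g (k, Suc j)\<close>, which is still below the limit because
      \<open>k < Suc i\<close>.\<close>
    then have "(g (k, Suc j), g (k, j)) \<in> r" unfolding covers_def U by auto
    then show False by (auto simp: g omega_squared_def)
  qed
  have nocov_top: "\<nexists>\<beta>. covers r \<beta> \<Omega>"
  proof
    assume "\<exists>\<beta>. covers r \<beta> \<Omega>"
    then obtain k j where "covers r (g (k, j)) \<Omega>"
      unfolding covers_def R by auto
    then have "(g (k, Suc j), g (k, j)) \<in> r" unfolding covers_def R by auto
    then show False by (auto simp: g omega_squared_def)
  qed
  have A: "weak_sim_approx \<tau> L r (g (i, j)) = (sim_step \<tau> L ^^ j) (limit_approx \<tau> L i)" for i j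
  proof (induction i arbitrary: j rule: less_induct)
    case (less i)
    show ?case
    proof (induction j)
      case 0
      show ?case
      proof (cases i)
        case 0
        have "underS r (g (0, 0)) = {}" unfolding U by auto
        then show ?thesis using W 0 by (simp add: weak_sim_approx_zero)
      next
        case (Suc i')
        have "weak_sim_approx \<tau> L r (g (i, 0)) =
            (\<Inter>\<beta> \<in> underS r (g (i, 0)). weak_sim_approx \<tau> L r \<beta>)"
          unfolding Suc by (rule weak_sim_approx_limit[OF W _ nocov]) (auto simp: U)
        also have "\<dots> = (\<Inter>k\<in>{..<i}. \<Inter>j. (sim_step \<tau> L ^^ j) (limit_approx \<tau> L k))"
          unfolding U by (auto simp: less)
        \<comment> \<open>The last block \<open>k = i'\<close> alone gives this limit level; the
          lower blocks add no constraint because the limit levels decrease.\<close>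
        also have "\<dots> = limit_approx \<tau> L i"
        proof
          show "limit_approx \<tau> L i \<subseteq>
              (\<Inter>k\<in>{..<i}. \<Inter>j. (sim_step \<tau> L ^^ j) (limit_approx \<tau> L k))"
            by (intro INT_greatest limit_approx_subset_iterate) simp
        qed (use Suc in auto)
        finally show ?thesis by simp
      qed
    next
      case (Suc j)
      then show ?case by (simp add: weak_sim_approx_succ[OF W cov])
    qed
  qed
  then show "weak_sim_approx \<tau> L r (g (i, j)) = (sim_step \<tau> L ^^ j) (limit_approx \<tau> L i)" .
  have "weak_sim_approx \<tau> L r \<Omega> = (\<Inter>\<beta> \<in> underS r \<Omega>. weak_sim_approx \<tau> L r \<beta>)"
    by (rule weak_sim_approx_limit[OF W _ nocov_top]) (auto simp: R)
  also have "\<dots> = (\<Inter>i. limit_approx \<tau> L (Suc i))"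
    unfolding R by (auto simp: A)
  also have "\<dots> = (\<Inter>i. limit_approx \<tau> L i)"
  proof (intro equalityI INT_greatest)
    show "(\<Inter>i. limit_approx \<tau> L (Suc i)) \<subseteq> limit_approx \<tau> L i" for i
      by (rule INF_lower2[of i]) (simp_all add: limit_approx_antimono del: limit_approx.simps)
    show "(\<Inter>i. limit_approx \<tau> L i) \<subseteq> limit_approx \<tau> L (Suc i)" for i
      by (rule INF_lower) simp
  qed
  finally show "weak_sim_approx \<tau> L r \<Omega> = (\<Inter>i. limit_approx \<tau> L i)" .
qed

section \<open>Convergence\<close>

text \<open>What the convergence proof uses of a one-counter net: finitely many controls, and
  transitions that stay enabled when the counter is increased.\<close>

locale counter_lts =
  fixes L :: "('s, 'a) lts" and C :: "'c set" and conf :: "'c \<Rightarrow> nat \<Rightarrow> 's"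
  assumes finite_C: "finite C"
    and states_eq: "states L = {conf c n | c n. c \<in> C}"
    and step_shift: "\<And>c m a t. \<lbrakk>c \<in> C; (conf c m, t) \<in> strong_step L a\<rbrakk> \<Longrightarrow>
      \<exists>c'\<in>C. \<exists>m'. t = conf c' m' \<and> (\<forall>k. (conf c (m + k), conf c' (m' + k)) \<in> strong_step L a)"
begin

section \<open>Lifting runs and relations to larger counters\<close>

lemma steps_shift:
  assumes "(conf c m, t) \<in> (strong_step L a)\<^sup>*" "c \<in> C"
  shows "\<exists>c'\<in>C. \<exists>m'. t = conf c' m' \<and>
    (\<forall>k. (conf c (m + k), conf c' (m' + k)) \<in> (strong_step L a)\<^sup>*)"
  using assms(1)
proof (induction rule: rtrancl_induct)
  case base
  show ?case using assms(2) by blast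
next
  case (step t u)
  then obtain d n where d: "d \<in> C" "t = conf d n"
    and *: "\<And>k. (conf c (m + k), conf d (n + k)) \<in> (strong_step L a)\<^sup>*" by blast
  with step_shift[of d n u a] step.hyps obtain e l where e: "e \<in> C" "u = conf e l"
    and **: "\<And>k. (conf d (n + k), conf e (l + k)) \<in> strong_step L a" by blast
  have "(conf c (m + k), conf e (l + k)) \<in> (strong_step L a)\<^sup>*" for k
    using *[of k] **[of k] by (rule rtrancl_into_rtrancl)
  with e show ?case by blast
qed

lemma weak_step_shift:
  assumes "(conf c m, t) \<in> weak_step \<tau> L a" "c \<in> C"
  shows "\<exists>c'\<in>C. \<exists>m'. t = conf c' m' \<and> (\<forall>k. (conf c (m + k), conf c' (m' + k)) \<in> weak_step \<tau> L a)"
proof (cases "a = \<tau>")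
  case True
  then show ?thesis using steps_shift assms by (simp add: weak_step_def)
next
  case False
  then obtain u v where u: "(conf c m, u) \<in> (strong_step L \<tau>)\<^sup>*"
    and v: "(u, v) \<in> strong_step L a" and t: "(v, t) \<in> (strong_step L \<tau>)\<^sup>*"
    using assms by (auto simp: weak_step_def)
  obtain d n where d: "d \<in> C" "u = conf d n"
    and 1: "\<And>k. (conf c (m + k), conf d (n + k)) \<in> (strong_step L \<tau>)\<^sup>*"
    using steps_shift[OF u assms(2)] by blast
  obtain e l where e: "e \<in> C" "v = conf e l"
    and 2: "\<And>k. (conf d (n + k), conf e (l + k)) \<in> strong_step L a"
    using step_shift[of d n v a] v d by blast
  obtain f i where f: "f \<in> C" "t = conf f i"
    and 3: "\<And>k. (conf e (l + k), conf f (i + k)) \<in> (strong_step L \<tau>)\<^sup>*"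
    using steps_shift[of e l t \<tau>] t e by blast
  have "(conf c (m + k), conf f (i + k)) \<in> weak_step \<tau> L a" for k
    using False 1[of k] 2[of k] 3[of k] by (auto simp: weak_step_def)
  with f show ?thesis by blast
qed

text \<open>The two directions differ because a larger counter enables more moves: this helps the
  duplicator on the right and the spoiler on the left.\<close>

definition counter_monotone :: "'s rel \<Rightarrow> bool" where
  "counter_monotone R \<longleftrightarrow> (\<forall>c\<in>C. \<forall>d\<in>C. \<forall>m n m' n'.
     (conf c m, conf d n) \<in> R \<longrightarrow> m' \<le> m \<longrightarrow> n \<le> n' \<longrightarrow> (conf c m', conf d n') \<in> R)"

lemma counter_monotoneD:
  "\<lbrakk>counter_monotone R; (conf c m, conf d n) \<in> R; c \<in> C; d \<in> C; m' \<le> m; n \<le> n'\<rbrakk> \<Longrightarrow>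
    (conf c m', conf d n') \<in> R"
  unfolding counter_monotone_def by blast

lemma counter_monotone_INT:
  fixes R :: "'i \<Rightarrow> 's rel"
  assumes "\<And>j. counter_monotone (R j)"
  shows "counter_monotone (\<Inter>j. R j)"
  unfolding counter_monotone_def by (auto intro: counter_monotoneD[OF assms])

text \<open>The attack from \<open>m'\<close> is lifted to \<open>m\<close> and answered there, and
  the answer is lifted by \<open>n' - n\<close>; monotonicity of \<open>R\<close> relates the
  original target to the lifted answer.\<close>

lemma counter_monotone_sim_step:
  assumes R: "counter_monotone R"
  shows "counter_monotone (sim_step \<tau> L R)"
  unfolding counter_monotone_def
proof (intro ballI allI impI)
  fix c d m n m' n'
  assume c: "c \<in> C" and d: "d \<in> C" and le: "m' \<le> m" "n \<le> n'"
    and cd: "(conf c m, conf d n) \<in> sim_step \<tau> L R"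
  have "\<exists>t'. (conf d n', t') \<in> weak_step \<tau> L a \<and> (t, t') \<in> R"
    if t: "(conf c m', t) \<in> strong_step L a" for a t
  proof -
    obtain e l where e: "e \<in> C" "t = conf e l"
      and sh: "\<And>k. (conf c (m' + k), conf e (l + k)) \<in> strong_step L a"
      using step_shift[OF c t] by blast
    have "(conf c m, conf e (l + (m - m'))) \<in> strong_step L a"
      using sh[of "m - m'"] le by simp
    then obtain t' where t': "(conf d n, t') \<in> weak_step \<tau> L a" "(conf e (l + (m - m')), t') \<in> R"
      using cd by (auto simp: sim_step_def)
    obtain f i where f: "f \<in> C" "t' = conf f i"
      and sh': "\<And>k. (conf d (n + k), conf f (i + k)) \<in> weak_step \<tau> L a"
      using weak_step_shift[OF t'(1) d] by blast
    have "(conf d n', conf f (i + (n' - n))) \<in> weak_step \<tau> L a"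
      using sh'[of "n' - n"] le by simp
    moreover have "(t, conf f (i + (n' - n))) \<in> R"
      using counter_monotoneD[OF R] t'(2) e f by simp
    ultimately show ?thesis by blast
  qed
  then show "(conf c m', conf d n') \<in> sim_step \<tau> L R"
    using c d by (auto simp: sim_step_def states_eq)
qed

lemma counter_monotone_iterate:
  "counter_monotone R \<Longrightarrow> counter_monotone ((sim_step \<tau> L ^^ j) R)"
  by (induction j) (auto intro: counter_monotone_sim_step)

lemma counter_monotone_limit_approx: "counter_monotone (limit_approx \<tau> L i)"
proof (induction i)
  case 0
  show ?case by (auto simp: counter_monotone_def states_eq)
next
  case (Suc i)
  then have "counter_monotone ((sim_step \<tau> L ^^ j) (limit_approx \<tau> L i))" for j
    by (rule counter_monotone_iterate)
  then show ?case unfolding limit_approx.simps by (rule counter_monotone_INT)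
qed

section \<open>Stabilisation and convergence\<close>

text \<open>Some control occurs in answers at infinitely many levels. If its answers have bounded
  counters, a second pigeonhole step fixes one answer for all levels; otherwise
  \<open>stable\<close> names a sufficient counter and some answer reaches beyond it.\<close>

lemma weak_simulation_if_stable:
  fixes \<tau> R
  defines "Rl \<equiv> \<Inter>j. (sim_step \<tau> L ^^ j) R"
  assumes mono: "counter_monotone R" and dec: "sim_step \<tau> L R \<subseteq> R"
    and sub: "R \<subseteq> states L \<times> states L"
    and stable: "\<And>c d m n. \<lbrakk>c \<in> C; d \<in> C; (conf c m, conf d n) \<in> R\<rbrakk> \<Longrightarrow>
      \<exists>n'. (conf c m, conf d n') \<in> Rl"
  shows "is_weak_simulation \<tau> L Rl"
  unfolding is_weak_simulation_iff_sim_step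
proof (rule subrelI)
  let ?R = "\<lambda>j. (sim_step \<tau> L ^^ j) R"
  have anti: "j \<le> k \<Longrightarrow> ?R k \<subseteq> ?R j" for j k
    using iterate_sim_step_antimono[OF dec] .
  have Rl_mono: "counter_monotone Rl"
    unfolding Rl_def by (intro counter_monotone_INT counter_monotone_iterate mono)
  fix s s' assume ss': "(s, s') \<in> Rl"
  then have st: "s \<in> states L" "s' \<in> states L"
    using sub INT_D[of "(s, s')" ?R UNIV 0] unfolding Rl_def by auto
  have "\<exists>t'. (s', t') \<in> weak_step \<tau> L a \<and> (t, t') \<in> Rl" if t: "(s, t) \<in> strong_step L a" for a t
  proof -
    obtain c0 m0 where "c0 \<in> C" "s = conf c0 m0" using st states_eq by blast
    then obtain c m where c: "c \<in> C" "t = conf c m" using t step_shift[of c0 m0 t a] by blast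
    obtain d0 n0 where d0: "d0 \<in> C" "s' = conf d0 n0" using st states_eq by blast
    \<comment> \<open>Membership at level \<open>Suc j\<close> yields an answer good at level
      \<open>j\<close>; this answer may vary with \<open>j\<close>.\<close>
    have "\<exists>d\<in>C. \<exists>n. (s', conf d n) \<in> weak_step \<tau> L a \<and> (t, conf d n) \<in> ?R j" for j
    proof -
      have "(s, s') \<in> sim_step \<tau> L (?R j)"
        using ss' INT_D[of "(s, s')" ?R UNIV "Suc j"] unfolding Rl_def by simp
      then obtain t' where t': "(s', t') \<in> weak_step \<tau> L a" "(t, t') \<in> ?R j"
        using t by (auto simp: sim_step_def)
      then show ?thesis using weak_step_shift[of d0 n0 t' \<tau> a] d0 by blast
    qed
    then obtain D N where D: "\<And>j. D j \<in> C"
      and DN: "\<And>j. (s', conf (D j) (N j)) \<in> weak_step \<tau> L a" "\<And>j. (t, conf (D j) (N j)) \<in> ?R j"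
      by metis
    obtain d where d: "d \<in> C" "infinite {j. D j = d}"
    proof -
      have "finite (range D)" using finite_subset[OF _ finite_C] D by blast
      from pigeonhole_infinite[OF infinite_UNIV_nat this] show ?thesis using that D by auto
    qed
    show ?thesis
    proof (cases "finite {n. (s', conf d n) \<in> weak_step \<tau> L a}")
      case True
      have "N ` {j. D j = d} \<subseteq> {n. (s', conf d n) \<in> weak_step \<tau> L a}" using DN(1) by auto
      then have "finite (N ` {j. D j = d})" using True finite_subset by blast
      then obtain j0 where j0: "D j0 = d" "infinite {j. D j = d \<and> N j = N j0}"
        using pigeonhole_infinite[OF d(2)] by force
      \<comment> \<open>The same answer recurs at some level beyond any given \<open>k\<close>, and
        the iterates decrease.\<close>
      have "(t, conf d (N j0)) \<in> ?R k" for k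
      proof -
        obtain j where "k \<le> j" "D j = d" "N j = N j0"
          using j0(2) by (auto simp: infinite_nat_iff_unbounded_le)
        then show ?thesis using DN(2)[of j] anti[of k j] by auto
      qed
      then have "(t, conf d (N j0)) \<in> Rl" by (auto simp: Rl_def)
      then show ?thesis using DN(1)[of j0] j0(1) by auto
    next
      case False
      obtain j where j: "D j = d" using d(2) by (metis (mono_tags) Collect_empty_eq finite.emptyI)
      have "(t, conf d (N j)) \<in> R" using DN(2)[of j] anti[of 0 j] j by auto
      \<comment> \<open>This \<open>n\<close> need not itself be the counter of an answer; an answer
        with a larger counter \<open>n'\<close> serves by monotonicity.\<close>
      then obtain n where n: "(conf c m, conf d n) \<in> Rl" using stable c d by blast
      obtain n' where "n \<le> n'" "(s', conf d n') \<in> weak_step \<tau> L a"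
        using False by (auto simp: infinite_nat_iff_unbounded_le)
      then show ?thesis using counter_monotoneD[OF Rl_mono n] c d by blast
    qed
  qed
  then show "(s, s') \<in> sim_step \<tau> L Rl"
    using st by (auto simp: sim_step_def)
qed

text \<open>For one pair of controls, the spoiler counters eventually rejected for every duplicator
  counter form an upward closed set. A level rejecting its least element \<open>m0\<close> rejects
  the whole set, so nothing changes later; the maximum over the finitely many pairs serves them
  all.\<close>

lemma limit_approx_stable:
  "\<exists>i. \<forall>c\<in>C. \<forall>d\<in>C. \<forall>m. (\<exists>n. (conf c m, conf d n) \<in> limit_approx \<tau> L i) \<longrightarrow>
     (\<forall>j. \<exists>n. (conf c m, conf d n) \<in> limit_approx \<tau> L j)"
proof -
  let ?E = "\<lambda>i x m. \<exists>n. (conf (fst x) m, conf (snd x) n) \<in> limit_approx \<tau> L i"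
  have anti: "?E i x m" if "?E j x m" "i \<le> j" for i j x m
    using that limit_approx_antimono[of i j \<tau> L] by blast
  have down: "?E i x m" if "?E i x m'" "m \<le> m'" "x \<in> C \<times> C" for i x m m'
  proof -
    from that(1) obtain n where "(conf (fst x) m', conf (snd x) n) \<in> limit_approx \<tau> L i" by blast
    then have "(conf (fst x) m, conf (snd x) n) \<in> limit_approx \<tau> L i"
      by (rule counter_monotoneD[OF counter_monotone_limit_approx]) (use that in auto)
    then show ?thesis by blast
  qed
  have "\<exists>i. \<forall>k\<ge>i. \<forall>m. ?E k x m \<longrightarrow> (\<forall>j. ?E j x m)" if x: "x \<in> C \<times> C" for x
  proof (cases "\<exists>m j. \<not> ?E j x m")
    case True
    define m0 where "m0 = (LEAST m. \<exists>j. \<not> ?E j x m)"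
    obtain i where i: "\<not> ?E i x m0"
      using LeastI_ex[OF True] unfolding m0_def by blast
    have "?E j x m" if k: "i \<le> k" "?E k x m" for k m j
    proof -
      have "m < m0" using i anti[OF k(2,1)] down[OF _ _ x] by (meson not_le)
      then show ?thesis using not_less_Least unfolding m0_def by blast
    qed
    then show ?thesis by blast
  qed blast
  then obtain f where f: "\<And>x k m j. \<lbrakk>x \<in> C \<times> C; f x \<le> k; ?E k x m\<rbrakk> \<Longrightarrow> ?E j x m"
    by metis
  have le: "f x \<le> Max (f ` (C \<times> C))" if "x \<in> C \<times> C" for x
    using that finite_C by auto
  show ?thesis
  proof (rule exI[of _ "Max (f ` (C \<times> C))"], intro ballI allI impI)
    fix c d m j
    assume "c \<in> C" "d \<in> C"
      and "\<exists>n. (conf c m, conf d n) \<in> limit_approx \<tau> L (Max (f ` (C \<times> C)))"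
    then show "\<exists>n. (conf c m, conf d n) \<in> limit_approx \<tau> L j"
      using f[of "(c, d)" "Max (f ` (C \<times> C))" m j] le[of "(c, d)"] by simp
  qed
qed

text \<open>For a stable \<open>i\<close>, level \<omega> \<cdot> (i + 1) is already a weak
  simulation. Since \<open>i\<close> depends on the system, the intersection over all limit levels
  is taken to get a uniform bound.\<close>

theorem limit_approx_converges: "(\<Inter>i. limit_approx \<tau> L i) = weak_sim \<tau> L"
proof
  obtain i where i: "\<And>c d m n j. \<lbrakk>c \<in> C; d \<in> C; (conf c m, conf d n) \<in> limit_approx \<tau> L i\<rbrakk> \<Longrightarrow>
     \<exists>n. (conf c m, conf d n) \<in> limit_approx \<tau> L j"
    using limit_approx_stable[of \<tau>] by blast
  have "is_weak_simulation \<tau> L (limit_approx \<tau> L (Suc i))"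
    unfolding limit_approx.simps
    using i[where j = "Suc i", unfolded limit_approx.simps]
    by (intro weak_simulation_if_stable counter_monotone_limit_approx
        sim_step_limit_approx_subset limit_approx_subset_states)
  then show "(\<Inter>i. limit_approx \<tau> L i) \<subseteq> weak_sim \<tau> L"
    by (intro INF_lower2[of "Suc i"] weak_sim_largest(2)) simp_all
  show "weak_sim \<tau> L \<subseteq> (\<Inter>i. limit_approx \<tau> L i)"
    by (intro INT_greatest weak_sim_subset_limit_approx)
qed

end

section \<open>One-counter nets as an instance\<close>

text \<open>Transitions of the union never change sides, and a rule that fires at counter
  \<open>m\<close> also fires at \<open>m + k\<close> with the same effect, which raises the target
  counter by \<open>k\<close>.\<close>

lemma counter_lts_disjoint_union:
  fixes N :: "('p, 'a) ocn" and N' :: "('q, 'a) ocn"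
  assumes "is_ocn \<tau> N" "is_ocn \<tau> N'"
  shows "counter_lts (lts_disjoint_union (ocn_lts N) (ocn_lts N')) (ctrl N <+> ctrl N')
    (\<lambda>c n. map_sum (\<lambda>p. (p, n)) (\<lambda>q. (q, n)) c)"
proof
  show "finite (ctrl N <+> ctrl N')" using assms by (simp add: is_ocn_def)
  show "states (lts_disjoint_union (ocn_lts N) (ocn_lts N')) =
    {map_sum (\<lambda>p. (p, n)) (\<lambda>q. (q, n)) c | c n. c \<in> ctrl N <+> ctrl N'}"
    (is "?S = ?T")
  proof (rule set_eqI)
    show "x \<in> ?S \<longleftrightarrow> x \<in> ?T" for x
    proof (cases x)
      case (Inl y)
      then have "x = map_sum (\<lambda>p. (p, snd y)) (\<lambda>q. (q, snd y)) (Inl (fst y))" by simp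
      with Inl show ?thesis by (cases y) (fastforce simp: lts_disjoint_union_def ocn_lts_def)
    next
      case (Inr y)
      then have "x = map_sum (\<lambda>p. (p, snd y)) (\<lambda>q. (q, snd y)) (Inr (fst y))" by simp
      with Inr show ?thesis by (cases y) (fastforce simp: lts_disjoint_union_def ocn_lts_def)
    qed
  qed
next
  have *: "rules N \<subseteq> ctrl N \<times> UNIV \<times> UNIV \<times> ctrl N" "rules N' \<subseteq> ctrl N' \<times> UNIV \<times> UNIV \<times> ctrl N'"
    using assms by (auto simp: is_ocn_def)
  fix c m a t
  assume "c \<in> ctrl N <+> ctrl N'"
    and "(map_sum (\<lambda>p. (p, m)) (\<lambda>q. (q, m)) c, t) \<in>
      strong_step (lts_disjoint_union (ocn_lts N) (ocn_lts N')) a"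
  then show "\<exists>c'\<in>ctrl N <+> ctrl N'. \<exists>m'. t = map_sum (\<lambda>p. (p, m')) (\<lambda>q. (q, m')) c' \<and>
     (\<forall>k. (map_sum (\<lambda>p. (p, m + k)) (\<lambda>q. (q, m + k)) c,
           map_sum (\<lambda>p. (p, m' + k)) (\<lambda>q. (q, m' + k)) c') \<in>
        strong_step (lts_disjoint_union (ocn_lts N) (ocn_lts N')) a)"
  proof (cases c)
    case (Inl p)
    with \<open>(_, t) \<in> _\<close> obtain q n d where q: "t = Inl (q, n)" "(p, a, d, q) \<in> rules N" "int n = int m + d"
      by (auto simp: strong_step_def lts_disjoint_union_def ocn_lts_def)
    show ?thesis
      using q * Inl by (intro bexI[of _ "Inl q"] exI[of _ n])
        (auto simp: strong_step_def lts_disjoint_union_def ocn_lts_def intro!: exI[of _ d])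
  next
    case (Inr p)
    with \<open>(_, t) \<in> _\<close> obtain q n d where q: "t = Inr (q, n)" "(p, a, d, q) \<in> rules N'" "int n = int m + d"
      by (auto simp: strong_step_def lts_disjoint_union_def ocn_lts_def)
    show ?thesis
      using q * Inr by (intro bexI[of _ "Inr q"] exI[of _ n])
        (auto simp: strong_step_def lts_disjoint_union_def ocn_lts_def intro!: exI[of _ d])
  qed
qed

section \<open>Optimality\<close>

text \<open>The spoiler, never stuck on the visible action \<open>1\<close>. Label \<open>0\<close>
  is listed because \<open>is_ocn\<close> asks for the silent action among the labels.\<close>

definition loop_net :: "(nat, nat) ocn" where
  "loop_net = \<lparr>ctrl = {0}, acts = {0, 1}, rules = {(0, 1, 0, 0)}\<rparr>"

text \<open>Action \<open>0\<close> is silent. An even control can answer as many actions \<open>1\<close> as the counter allows; passing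
  through the odd control below it resets the counter to an arbitrarily large value.\<close>

definition reset_net :: "nat \<Rightarrow> (nat, nat) ocn" where
  "reset_net k = \<lparr>ctrl = {..2 * k}, acts = {0, 1},
     rules = {(p, 1, -1, p) | p. p \<le> 2 * k \<and> even p} \<union> {(p, 0, 1, p) | p. p \<le> 2 * k \<and> odd p} \<union>
       {(Suc p, 0, 0, p) | p. p < 2 * k}\<rparr>"

abbreviation loop_reset_lts :: "nat \<Rightarrow> ((nat \<times> nat) + (nat \<times> nat), nat) lts" where
  "loop_reset_lts k \<equiv> lts_disjoint_union (ocn_lts loop_net) (ocn_lts (reset_net k))"

lemma is_ocn_loop_net: "is_ocn 0 loop_net"
  by (auto simp: is_ocn_def loop_net_def)

lemma is_ocn_reset_net: "is_ocn 0 (reset_net k)"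
  by (auto simp: is_ocn_def reset_net_def)

lemma loop_step_iff:
  "(Inl (p, m), t) \<in> strong_step (loop_reset_lts k) a \<longleftrightarrow> p = 0 \<and> a = 1 \<and> t = Inl (0, m)"
  by (auto simp: strong_step_def lts_disjoint_union_def ocn_lts_def loop_net_def)

lemma reset_tau_step_iff:
  "(Inr (p, m), t) \<in> strong_step (loop_reset_lts k) 0 \<longleftrightarrow>
     p \<le> 2 * k \<and> (odd p \<and> t = Inr (p, Suc m) \<or> (\<exists>q. p = Suc q \<and> t = Inr (q, m)))"
  by (auto simp: strong_step_def lts_disjoint_union_def ocn_lts_def reset_net_def)

lemma reset_visible_step_iff:
  "(Inr (p, m), t) \<in> strong_step (loop_reset_lts k) (Suc 0) \<longleftrightarrow>
     p \<le> 2 * k \<and> even p \<and> (\<exists>n. m = Suc n \<and> t = Inr (p, n))"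
  by (auto simp: strong_step_def lts_disjoint_union_def ocn_lts_def reset_net_def)

lemma weak_stepI:
  "\<lbrakk>a \<noteq> \<tau>; (s, u) \<in> (strong_step L \<tau>)\<^sup>*; (u, t) \<in> strong_step L a\<rbrakk> \<Longrightarrow> (s, t) \<in> weak_step \<tau> L a"
  by (auto simp: weak_step_def)

section \<open>Surviving below a given level\<close>

lemma reset_pump:
  assumes "odd p" "p \<le> 2 * k"
  shows "(Inr (p, 0), Inr (p, n)) \<in> (strong_step (loop_reset_lts k) 0)\<^sup>*"
proof (induction n)
  case (Suc n)
  moreover have "(Inr (p, n), Inr (p, Suc n)) \<in> strong_step (loop_reset_lts k) 0"
    using assms by (simp add: reset_tau_step_iff)
  ultimately show ?case by (rule rtrancl_into_rtrancl)
qed simp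

text \<open>The only attack of the loop leads back to the same configuration, so a single answer
  related by \<open>R\<close> suffices.\<close>

lemma loop_sim_step_resetI:
  assumes "(Inr (q, n), Inr (q', n')) \<in> weak_step 0 (loop_reset_lts k) 1" "q \<le> 2 * k"
    and "(Inl (0, m), Inr (q', n')) \<in> R"
  shows "(Inl (0, m), Inr (q, n)) \<in> sim_step 0 (loop_reset_lts k) R"
proof -
  have "Inl (0, m) \<in> states (loop_reset_lts k)" "Inr (q, n) \<in> states (loop_reset_lts k)"
    using assms(2) by (auto simp: lts_disjoint_union_def ocn_lts_def loop_net_def reset_net_def)
  then show ?thesis using assms unfolding sim_step_def by (auto simp: loop_step_iff)
qed

text \<open>At control \<open>2 * i\<close> with counter \<open>n\<close> the duplicator survives
  \<omega> \<cdot> i + n levels: each unit of the counter pays for one level, and each of the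
  \<open>i\<close> resets for a limit.\<close>

lemma loop_approx_reset:
  assumes "i \<le> k"
  shows "(Inl (0, m), Inr (2 * i, n)) \<in>
    (sim_step 0 (loop_reset_lts k) ^^ n) (limit_approx 0 (loop_reset_lts k) i)"
  using assms
proof (induction i arbitrary: n)
  case 0
  show ?case
  proof (induction n)
    case 0
    show ?case by (auto simp: lts_disjoint_union_def ocn_lts_def loop_net_def reset_net_def)
  next
    case (Suc n)
    have "(Inr (0, Suc n), Inr (0, n)) \<in> weak_step 0 (loop_reset_lts k) 1"
      by (rule weak_stepI[OF _ rtrancl_refl]) (simp_all add: reset_visible_step_iff)
    then show ?case using Suc loop_sim_step_resetI by simp
  qed
next
  case (Suc i)
  let ?L = "loop_reset_lts k"
  show ?case
  proof (induction n)
    case 0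
    \<comment> \<open>Every finite \<open>j\<close> must be survived: the odd control pumps the
      counter to \<open>Suc j\<close>, and the visible action leaves \<open>j\<close>, enough for
      \<open>j\<close> levels above \<omega> \<cdot> i.\<close>
    have "(Inl (0, m), Inr (2 * Suc i, 0)) \<in> (sim_step 0 ?L ^^ Suc j) (limit_approx 0 ?L i)" for j
    proof -
      have "(Inr (2 * Suc i, 0), Inr (2 * i + 1, 0)) \<in> (strong_step ?L 0)\<^sup>*"
        using Suc.prems by (intro r_into_rtrancl) (simp add: reset_tau_step_iff)
      also have "(Inr (2 * i + 1, 0), Inr (2 * i + 1, Suc j)) \<in> (strong_step ?L 0)\<^sup>*"
        using Suc.prems by (intro reset_pump) auto
      also have "(Inr (2 * i + 1, Suc j), Inr (2 * i, Suc j)) \<in> strong_step ?L 0"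
        using Suc.prems by (simp add: reset_tau_step_iff)
      finally have "(Inr (2 * Suc i, 0), Inr (2 * i, Suc j)) \<in> (strong_step ?L 0)\<^sup>*" .
      moreover have "(Inr (2 * i, Suc j), Inr (2 * i, j)) \<in> strong_step ?L 1"
        using Suc.prems by (auto simp: reset_visible_step_iff)
      ultimately have "(Inr (2 * Suc i, 0), Inr (2 * i, j)) \<in> weak_step 0 ?L 1"
        by (intro weak_stepI) simp
      moreover have "(Inl (0, m), Inr (2 * i, j)) \<in> (sim_step 0 ?L ^^ j) (limit_approx 0 ?L i)"
        using Suc by simp
      ultimately show ?thesis
        using Suc.prems loop_sim_step_resetI[of "2 * Suc i"] by simp
    qed
    \<comment> \<open>Answering one attack gained a level; since the iterates decrease, all
      \<open>j\<close> are covered, including \<open>0\<close>.\<close>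
    then have "(Inl (0, m), Inr (2 * Suc i, 0)) \<in> (sim_step 0 ?L ^^ j) (limit_approx 0 ?L i)" for j
      using subsetD[OF iterate_sim_step_antimono[OF sim_step_limit_approx_subset, of j "Suc j"]]
      by (metis le_SucI order_refl)
    then show ?case by simp
  next
    case (Suc n)
    have "(Inr (2 * Suc i, Suc n), Inr (2 * Suc i, n)) \<in> weak_step 0 ?L 1"
      using \<open>Suc i \<le> k\<close>
      by (intro weak_stepI[OF _ rtrancl_refl]) (simp_all add: reset_visible_step_iff)
    from loop_sim_step_resetI[OF this _ Suc] \<open>Suc i \<le> k\<close> show ?case by simp
  qed
qed

section \<open>Descent of the duplicator\<close>

text \<open>A silent move from an even control must lower it, and a lowered control is never
  regained; only odd controls can pump.\<close>

lemma reset_tau_steps: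
  assumes "(Inr (p, m), t) \<in> (strong_step (loop_reset_lts k) 0)\<^sup>*"
  shows "\<exists>q n. t = Inr (q, n) \<and> (q < p \<or> q = p \<and> (even p \<longrightarrow> n = m))"
  using assms
proof (induction rule: rtrancl_induct)
  case (step t u)
  then obtain q n where "t = Inr (q, n)" "q < p \<or> q = p \<and> (even p \<longrightarrow> n = m)" by blast
  then show ?case using step.hyps(2) by (auto simp: reset_tau_step_iff)
qed simp

text \<open>Action \<open>1\<close> fires only at an even control. If this is still
  \<open>p\<close>, the counter has not been pumped and drops by one; otherwise the control has
  dropped. Later silent moves can only lower the control further.\<close>

lemma reset_weak_step_decreases:
  assumes "(Inr (p, m), t) \<in> weak_step 0 (loop_reset_lts k) 1"
  shows "\<exists>q n. t = Inr (q, n) \<and> ((q, n), (p, m)) \<in> less_than <*lex*> less_than"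
proof -
  obtain u v where u: "(Inr (p, m), u) \<in> (strong_step (loop_reset_lts k) 0)\<^sup>*"
    and v: "(u, v) \<in> strong_step (loop_reset_lts k) 1"
    and t: "(v, t) \<in> (strong_step (loop_reset_lts k) 0)\<^sup>*"
    using assms by (auto simp: weak_step_def)
  obtain p1 m1 where 1: "u = Inr (p1, m1)" "p1 < p \<or> p1 = p \<and> (even p \<longrightarrow> m1 = m)"
    using reset_tau_steps[OF u] by blast
  with v obtain m2 where 2: "even p1" "m1 = Suc m2" "v = Inr (p1, m2)"
    by (auto simp: reset_visible_step_iff)
  with t obtain q n where "t = Inr (q, n)" "q < p1 \<or> q = p1 \<and> n = m2"
    using reset_tau_steps by blast
  with 1 2 show ?thesis by auto
qed

text \<open>Infinite descent: the loop returns to itself at each attack, while every answer lowers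
  the duplicator's pair in a well-founded lexicographic order.\<close>

lemma loop_not_weak_sim_reset: "(Inl (0, m), Inr x) \<notin> weak_sim 0 (loop_reset_lts k)"
proof (induction x rule: wf_induct[OF wf_lex_prod[OF wf_less_than wf_less_than]])
  case (1 x)
  obtain q n where x: "x = (q, n)" by fastforce
  show ?case
  proof
    assume "(Inl (0, m), Inr x) \<in> weak_sim 0 (loop_reset_lts k)"
    moreover have "(Inl (0, m), Inl (0, m)) \<in> strong_step (loop_reset_lts k) 1"
      by (simp add: loop_step_iff)
    ultimately obtain t where "(Inr x, t) \<in> weak_step 0 (loop_reset_lts k) 1"
      "(Inl (0, m), t) \<in> weak_sim 0 (loop_reset_lts k)"
      using weak_sim_largest(1)[of 0 "loop_reset_lts k"] unfolding is_weak_simulation_def by fast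
    then show False using reset_weak_step_decreases[of q n t k] 1 x by blast
  qed
qed

theorem theorem5p21:
  fixes r :: "'o rel" and \<Omega> :: 'o
  assumes "represents_omega_squared r \<Omega>"
  shows "(\<forall>(\<tau> :: 'a) (N :: ('p, 'a) ocn) (N' :: ('q, 'a) ocn).
            is_ocn \<tau> N \<and> is_ocn \<tau> N' \<longrightarrow>
              weak_sim_approx \<tau> (lts_disjoint_union (ocn_lts N) (ocn_lts N')) r \<Omega> =
              weak_sim \<tau> (lts_disjoint_union (ocn_lts N) (ocn_lts N')))
       \<and> (\<forall>\<alpha> \<in> underS r \<Omega>.
            \<exists>(\<tau> :: nat) (N :: (nat, nat) ocn) (N' :: (nat, nat) ocn).
              is_ocn \<tau> N \<and> is_ocn \<tau> N' \<and>
              weak_sim_approx \<tau> (lts_disjoint_union (ocn_lts N) (ocn_lts N')) r \<alpha> \<noteq>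
              weak_sim \<tau> (lts_disjoint_union (ocn_lts N) (ocn_lts N')))"
proof -
  obtain g where g: "underS r \<Omega> = range g"
      "\<And>x y. (g x, g y) \<in> r \<longleftrightarrow> (x, y) \<in> omega_squared"
    by (rule represents_omega_squared_enum[OF assms]) blast
  show ?thesis
  proof (intro conjI allI impI ballI)
    fix \<tau> :: 'a and N :: "('p, 'a) ocn" and N' :: "('q, 'a) ocn"
    assume "is_ocn \<tau> N \<and> is_ocn \<tau> N'"
    then show "weak_sim_approx \<tau> (lts_disjoint_union (ocn_lts N) (ocn_lts N')) r \<Omega> =
        weak_sim \<tau> (lts_disjoint_union (ocn_lts N) (ocn_lts N'))"
      using counter_lts.limit_approx_converges[OF counter_lts_disjoint_union]
        weak_sim_approx_omega_squared(2)[OF assms g] by metis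
  next
    fix \<alpha> assume "\<alpha> \<in> underS r \<Omega>"
    then obtain i j where \<alpha>: "\<alpha> = g (i, j)" using g(1) by auto
    \<comment> \<open>With \<open>Suc i\<close> resets the separating pair survives level \<omega>
      \<cdot> (i + 1), which exceeds \<omega> \<cdot> i + j for every \<open>j\<close>.\<close>
    let ?L = "loop_reset_lts (Suc i)"
    have "(Inl (0, 0), Inr (2 * Suc i, 0)) \<in> limit_approx 0 ?L (Suc i)"
      using loop_approx_reset[of "Suc i" "Suc i" 0 0] by simp
    then have "(Inl (0, 0), Inr (2 * Suc i, 0)) \<in> weak_sim_approx 0 ?L r \<alpha>"
      unfolding \<alpha> weak_sim_approx_omega_squared(1)[OF assms g] by simp
    then have "weak_sim_approx 0 ?L r \<alpha> \<noteq> weak_sim 0 ?L"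
      using loop_not_weak_sim_reset by blast
    then show "\<exists>(\<tau> :: nat) (N :: (nat, nat) ocn) (N' :: (nat, nat) ocn).
        is_ocn \<tau> N \<and> is_ocn \<tau> N' \<and>
        weak_sim_approx \<tau> (lts_disjoint_union (ocn_lts N) (ocn_lts N')) r \<alpha> \<noteq>
        weak_sim \<tau> (lts_disjoint_union (ocn_lts N) (ocn_lts N'))"
      using is_ocn_loop_net is_ocn_reset_net by blast
  qed
qed

end
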